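(* Let $\mathbf{k}$ be an infinite field and let $\Delta$ be a $(d-1)$-dimensional homology manifold over $\mathbf{k}$ with (nonempty) boundary $\partial\Delta$. Then $$h_{d-i}(\Delta)-h_i(\Delta)=\binom{d}{i}(-1)^{d-1-i}\,\tilde{\chi}(\Delta)-g_i(\partial\Delta)\qquad\text{for all } 0\le i\le d,$$ where $g_i(\partial\Delta):=h_i(\partial\Delta)-h_{i-1}(\partial\Delta)$.
   Context: A simplicial complex on $[n]=\{1,\dots,n\}$ is a collection of subsets (faces) of $[n]$ closed under inclusion and containing all singletons; $\dim F=|F|-1$; the dimension of the complex is the maximal dimension of its faces; it is pure if all maximal faces have the same dimension. The link of a face $F$ is $\mathrm{lk}(F)=\{G\in\Delta: G\cap F=\emptyset,\ G\cup F\in\Delta\}$. A homology manifold over $\mathbf{k}$ of dimension $d-1$ is a pure $(d-1)$-dimensional simplicial complex $\Delta$ such that for every nonempty face $F\in\Delta$, $\tilde H_i(\mathrm{lk}\,F;\mathbf{k})=0$ for $i<d-|F|-1$ and $\tilde H_{d-|F|-1}(\mathrm{lk}\,F;\mathbf{k})$ is isomorphic to $\mathbf{k}$ or $0$. The boundary faces are the nonempty faces $F$ with $\tilde H_{d-|F|-1}(\mathrm{lk}\,F;\mathbf{k})=0$. If there are none, $\Delta$ is a homology manifold without boundary. Otherwise $\partial\Delta$ is the set of boundary faces together with $\emptyset$, and it is a standing assumption that $\partial\Delta$ is a $(d-2)$-dimensional homology manifold without boundary. For a $(D-1)$-dimensional complex $\Gamma$, $f_i(\Gamma)$ is the number of $i$-dimensional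 faces ($f_{-1}=1$), and the $h$-vector $(h_0,\dots,h_D)$ is defined by $\sum_{i=0}^{D}h_i\lambda^i=\sum_{i=0}^{D}f_{i-1}\lambda^i(1-\lambda)^{D-i}$; $h_j(\Gamma):=0$ for $j<0$ or $j>D$. Here $D=d$ for $\Delta$ and $D=d-1$ for $\partial\Delta$. The reduced Euler characteristic is $\tilde\chi(\Delta)=\sum_{i=-1}^{d-1}(-1)^if_i(\Delta)$. *)

theory Defs
  imports Complex_Main "HOL-Computational_Algebra.Polynomial"
begin

text \<open>The empty face is required, so that \<open>f_num \<Delta> (-1) = 1\<close>.\<close>

definition simplicial_complex :: "'v set \<Rightarrow> 'v set set \<Rightarrow> bool" where
  "simplicial_complex V \<Delta> \<longleftrightarrow>
     finite V \<and> \<Delta> \<subseteq> Pow V \<and> {} \<in> \<Delta> \<and> (\<forall>v\<in>V. {v} \<in> \<Delta>) \<and>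
     (\<forall>F\<in>\<Delta>. \<forall>G. G \<subseteq> F \<longrightarrow> G \<in> \<Delta>)"

definition face_dim :: "'v set \<Rightarrow> int" where
  "face_dim F = int (card F) - 1"

definition complex_dim :: "'v set set \<Rightarrow> int" where
  "complex_dim \<Delta> = Max (face_dim ` \<Delta>)"

definition maximal_faces :: "'v set set \<Rightarrow> 'v set set" where
  "maximal_faces \<Delta> = {F \<in> \<Delta>. \<forall>G\<in>\<Delta>. F \<subseteq> G \<longrightarrow> G = F}"

definition pure_complex :: "'v set set \<Rightarrow> bool" where
  "pure_complex \<Delta> \<longleftrightarrow>
     (\<forall>F\<in>maximal_faces \<Delta>. \<forall>G\<in>maximal_faces \<Delta>. face_dim F = face_dim G)"

definition link :: "'v set set \<Rightarrow> 'v set \<Rightarrow> 'v set set" where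
  "link \<Delta> F = {G \<in> \<Delta>. G \<inter> F = {} \<and> G \<union> F \<in> \<Delta>}"


subsection \<open>Reduced simplicial homology with field coefficients\<close>

text \<open>An \<open>i\<close>-chain is a function on all vertex sets that vanishes off the \<open>i\<close>-dimensional
  faces. The index \<open>i\<close> is an integer; the empty face spans the chains of degree \<open>-1\<close>, which
  makes the homology reduced, and there are only zero chains in degrees below \<open>-1\<close>.\<close>

definition chains :: "'v set set \<Rightarrow> int \<Rightarrow> ('v set \<Rightarrow> 'k::field) set" where
  "chains \<Gamma> i = {c. \<forall>F. c F \<noteq> 0 \<longrightarrow> F \<in> \<Gamma> \<and> face_dim F = i}"

text \<open>The usual boundary map, with faces oriented by the order of the vertices, written
  coefficientwise: \<open>G\<close> arises from the face \<open>insert v G\<close> by deleting \<open>v\<close>, whose position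
  (counting from 0) in that face is the number of elements of \<open>G\<close> below \<open>v\<close>.\<close>

definition chain_boundary ::
    "'v::linorder set set \<Rightarrow> ('v set \<Rightarrow> 'k::field) \<Rightarrow> ('v set \<Rightarrow> 'k)" where
  "chain_boundary \<Gamma> c = (\<lambda>G. \<Sum>v\<in>\<Union>\<Gamma> - G. (-1) ^ card {w \<in> G. w < v} * c (insert v G))"

definition cycles :: "'v::linorder set set \<Rightarrow> int \<Rightarrow> ('v set \<Rightarrow> 'k::field) set" where
  "cycles \<Gamma> i = {c \<in> chains \<Gamma> i. chain_boundary \<Gamma> c = (\<lambda>_. 0)}"

definition boundaries :: "'v::linorder set set \<Rightarrow> int \<Rightarrow> ('v set \<Rightarrow> 'k::field) set" where
  "boundaries \<Gamma> i = chain_boundary \<Gamma> ` chains \<Gamma> (i + 1)"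

definition homology_class ::
    "'v::linorder set set \<Rightarrow> int \<Rightarrow> ('v set \<Rightarrow> 'k::field) \<Rightarrow> ('v set \<Rightarrow> 'k) set" where
  "homology_class \<Gamma> i z = {w \<in> cycles \<Gamma> i. (\<lambda>F. w F - z F) \<in> boundaries \<Gamma> i}"

definition homology :: "'v::linorder set set \<Rightarrow> int \<Rightarrow> ('v set \<Rightarrow> 'k::field) set set" where
  "homology \<Gamma> i = homology_class \<Gamma> i ` cycles \<Gamma> i"

definition homology_vanishes :: "'k::field itself \<Rightarrow> 'v::linorder set set \<Rightarrow> int \<Rightarrow> bool" where
  "homology_vanishes _ \<Gamma> i \<longleftrightarrow>
     (homology \<Gamma> i :: ('v set \<Rightarrow> 'k) set set) = {homology_class \<Gamma> i (\<lambda>_. 0)}"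

text \<open>There is a linear isomorphism from the quotient space onto the field; the vector space
  operations of the quotient are given on representatives.\<close>

definition homology_iso_field :: "'k::field itself \<Rightarrow> 'v::linorder set set \<Rightarrow> int \<Rightarrow> bool" where
  "homology_iso_field _ \<Gamma> i \<longleftrightarrow>
     (\<exists>\<phi> :: ('v set \<Rightarrow> 'k) set \<Rightarrow> 'k.
        bij_betw \<phi> (homology \<Gamma> i) UNIV \<and>
        (\<forall>x\<in>cycles \<Gamma> i. \<forall>y\<in>cycles \<Gamma> i.
           \<phi> (homology_class \<Gamma> i (\<lambda>F. x F + y F)) =
             \<phi> (homology_class \<Gamma> i x) + \<phi> (homology_class \<Gamma> i y)) \<and>
        (\<forall>a. \<forall>x\<in>cycles \<Gamma> i.
           \<phi> (homology_class \<Gamma> i (\<lambda>F. a * x F)) = a * \<phi> (homology_class \<Gamma> i x)))"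


subsection \<open>Homology manifolds\<close>

text \<open>For a complex of dimension \<open>d - 1\<close>, the degree \<open>complex_dim \<Delta> - int (card F)\<close> is
  \<open>d - |F| - 1\<close>.\<close>

definition homology_manifold ::
    "'k::field itself \<Rightarrow> 'v::linorder set \<Rightarrow> 'v set set \<Rightarrow> bool" where
  "homology_manifold K V \<Delta> \<longleftrightarrow>
     simplicial_complex V \<Delta> \<and> pure_complex \<Delta> \<and>
     (\<forall>F\<in>\<Delta>. F \<noteq> {} \<longrightarrow>
        (\<forall>i < complex_dim \<Delta> - int (card F). homology_vanishes K (link \<Delta> F) i) \<and>
        (homology_iso_field K (link \<Delta> F) (complex_dim \<Delta> - int (card F)) \<or>
         homology_vanishes K (link \<Delta> F) (complex_dim \<Delta> - int (card F))))"

definition boundary_faces :: "'k::field itself \<Rightarrow> 'v::linorder set set \<Rightarrow> 'v set set" where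
  "boundary_faces K \<Delta> =
     {F \<in> \<Delta>. F \<noteq> {} \<and> homology_vanishes K (link \<Delta> F) (complex_dim \<Delta> - int (card F))}"

definition homology_manifold_without_boundary ::
    "'k::field itself \<Rightarrow> 'v::linorder set \<Rightarrow> 'v set set \<Rightarrow> bool" where
  "homology_manifold_without_boundary K V \<Delta> \<longleftrightarrow>
     homology_manifold K V \<Delta> \<and> boundary_faces K \<Delta> = {}"

definition boundary_complex :: "'k::field itself \<Rightarrow> 'v::linorder set set \<Rightarrow> 'v set set" where
  "boundary_complex K \<Delta> = insert {} (boundary_faces K \<Delta>)"

text \<open>That the boundary complex is a homology manifold without boundary, of dimension one less,
  is part of the definition. Its vertex set may be smaller than that of \<open>\<Delta>\<close>.\<close>

definition homology_manifold_with_boundary ::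
    "'k::field itself \<Rightarrow> 'v::linorder set \<Rightarrow> 'v set set \<Rightarrow> bool" where
  "homology_manifold_with_boundary K V \<Delta> \<longleftrightarrow>
     homology_manifold K V \<Delta> \<and> boundary_faces K \<Delta> \<noteq> {} \<and>
     complex_dim (boundary_complex K \<Delta>) = complex_dim \<Delta> - 1 \<and>
     homology_manifold_without_boundary K (\<Union>(boundary_complex K \<Delta>)) (boundary_complex K \<Delta>)"


subsection \<open>Face numbers\<close>

definition f_num :: "'v set set \<Rightarrow> int \<Rightarrow> nat" where
  "f_num \<Gamma> i = card {F \<in> \<Gamma>. face_dim F = i}"

definition h_poly :: "'v set set \<Rightarrow> real poly" where
  "h_poly \<Gamma> = (let D = nat (complex_dim \<Gamma> + 1) in
     \<Sum>i=0..D. monom (real (f_num \<Gamma> (int i - 1))) i * [:1, -1:] ^ (D - i))"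

definition h_num :: "'v set set \<Rightarrow> int \<Rightarrow> real" where
  "h_num \<Gamma> j = (if j < 0 \<or> j > complex_dim \<Gamma> + 1 then 0 else coeff (h_poly \<Gamma>) (nat j))"

definition g_num :: "'v set set \<Rightarrow> int \<Rightarrow> real" where
  "g_num \<Gamma> i = h_num \<Gamma> i - h_num \<Gamma> (i - 1)"

definition reduced_euler_char :: "'v set set \<Rightarrow> real" where
  "reduced_euler_char \<Delta> = (\<Sum>i\<in>{-1..complex_dim \<Delta>}. (-1) powi i * real (f_num \<Delta> i))"

end

theory Submission
  imports Defs "HOL-Library.Function_Algebras"
begin

text \<open>
  Reversing the coefficients of \<open>h(\<Delta>)\<close> gives \<open>\<Sum>F\<in>\<Delta>. (\<lambda> - 1)^(d - |F|)\<close>. Expanding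
  \<open>1 = (\<lambda> + (1 - \<lambda>))^|F|\<close> over the subsets \<open>G\<close> of \<open>F\<close> turns this into
  \<open>\<Sum>G\<in>\<Delta>. w G * \<lambda>^|G| * (1 - \<lambda>)^(d - |G|)\<close>, where \<open>w G\<close> is, up to sign, the reduced
  Euler characteristic of the link of \<open>G\<close>. By the Euler-Poincare formula \<open>w G\<close> is \<open>1\<close> on interior
  faces and \<open>0\<close> on nonempty boundary faces, so the reversed polynomial differs from \<open>h(\<Delta>)\<close> only
  by the term of the empty face and by \<open>(1 - \<lambda>) h(\<partial>\<Delta>)\<close>, whose coefficients are
  the \<open>g\<close>-numbers of the boundary.
\<close>

subsection \<open>Linear algebra\<close>

text \<open>A basis of the kernel is extended to a basis of \<open>S\<close>; the added vectors map
  injectively onto a basis of the image. Finiteness is asked of \<open>S\<close> alone, because the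
  space of all functions on vertex sets may be infinite-dimensional.\<close>

lemma (in vector_space) rank_nullity:
  assumes lin: "Vector_Spaces.linear scale scale f"
    and S: "subspace S" and A: "finite A" "S \<subseteq> span A"
  shows "dim S = dim {x \<in> S. f x = 0} + dim (f ` S)"
proof -
  interpret f: Vector_Spaces.linear scale scale f by (fact lin)
  let ?K = "{x \<in> S. f x = 0}"
  obtain B0 where B0: "B0 \<subseteq> ?K" "independent B0" "?K \<subseteq> span B0"
    by (rule maximal_independent_subset)
  obtain B where B: "B0 \<subseteq> B" "B \<subseteq> S" "independent B" "S \<subseteq> span B"
    using maximal_independent_subset_extend[of B0 S] B0 by blast
  have finB: "finite B"
    using independent_span_bound[OF A(1) B(3)] B(2) A(2) by blast
  define C where "C = B - B0"
  have C: "C \<subseteq> B" "independent C" "B = B0 \<union> C" "B0 \<inter> C = {}"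
    using B independent_mono unfolding C_def by auto
  \<comment> \<open>A kernel vector in \<open>span C\<close> also lies in \<open>span B0\<close>, so
    its coordinates over \<open>B\<close> are supported in two disjoint sets and vanish.\<close>
  have "x = 0" if x: "x \<in> span C" "f x = 0" for x
  proof -
    have "x \<in> S"
      using x(1) C(1) B(2) S span_minimal[of C S] by blast
    with x B0 have x0: "x \<in> span B0" by blast
    have "representation B x = representation B0 x"
      using representation_extend[OF B(3) x0 B(1)] .
    moreover have "representation B x = representation C x"
      using representation_extend[OF B(3) x(1) C(1)] .
    ultimately have "representation B x b = 0" for b
      using representation_ne_zero[of B0 x b] representation_ne_zero[of C x b] C(4)
      by (metis disjoint_iff)
    then show ?thesis
      using sum_representation_eq[OF B(3), of x B] finB x0 span_mono[OF B(1)] by force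
  qed
  then have inj: "inj_on f (span C)"
    using f.inj_on_iff_eq_0[OF subspace_span] by blast
  have indep: "independent (f ` C)"
    using f.independent_injective_image[OF C(2) inj] .
  have "f ` S \<subseteq> span (f ` C)"
  proof
    fix y assume "y \<in> f ` S"
    then obtain x where x: "x \<in> S" "y = f x" by blast
    then have "x \<in> span (B0 \<union> C)" using B(4) C(3) by auto
    then obtain u v where uv: "u \<in> span B0" "v \<in> span C" "x = u + v"
      unfolding span_Un by blast
    have "f u = 0"
      using f.eq_0_on_span[of B0 u] B0(1) uv(1) by auto
    then show "y \<in> span (f ` C)"
      using x uv f.span_image[of C] by (auto simp: f.add)
  qed
  then have "dim (f ` S) = card (f ` C)"
    using indep C(1) B(2) by (intro basis_card_eq_dim[symmetric]) auto
  also have "\<dots> = card C"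
    using inj span_superset inj_on_subset by (intro card_image) blast
  finally have "dim (f ` S) = card C" .
  moreover have "dim ?K = card B0" "dim S = card B"
    using basis_card_eq_dim[OF B0(1,3,2)] basis_card_eq_dim[OF B(2,4,3)] by simp_all
  moreover have "card B = card B0 + card C"
    using C(3,4) finB by (simp add: card_Un_disjoint)
  ultimately show ?thesis by simp
qed

interpretation fun_space: vector_space "\<lambda>(a::'k::field) (c::'x \<Rightarrow> 'k) x. a * c x"
  by unfold_locales (auto simp: fun_eq_iff algebra_simps)

lemma sum_fun_apply: "(\<Sum>i\<in>I. f i) x = (\<Sum>i\<in>I. f i x)"
  by (induction I rule: infinite_finite_induct) auto

text \<open>The point masses at the elements of \<open>A\<close> form a basis. For chains,
  \<open>A\<close> is the set of \<open>i\<close>-dimensional faces: the dimension then counts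
  faces, and the finite span is what \<open>rank_nullity\<close> asks for.\<close>

lemma
  fixes A :: "'x set"
  assumes "finite A"
  defines "S \<equiv> {c :: 'x \<Rightarrow> 'k::field. \<forall>x. c x \<noteq> 0 \<longrightarrow> x \<in> A}"
  shows supported_finite_span: "\<exists>B. finite B \<and> S \<subseteq> fun_space.span B"
    and dim_supported: "fun_space.dim S = card A"
proof -
  define \<delta> where "\<delta> = (\<lambda>(a::'x) x. if x = a then 1 else (0::'k))"
  have inj: "inj_on \<delta> A"
    by (auto simp: inj_on_def \<delta>_def fun_eq_iff split: if_splits)
  have "fun_space.independent (\<delta> ` A)"
  proof (rule fun_space.independent_if_scalars_zero)
    show "finite (\<delta> ` A)" using assms by simp
  next
    fix u :: "('x \<Rightarrow> 'k) \<Rightarrow> 'k" and b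
    assume u: "(\<Sum>x\<in>\<delta> ` A. (\<lambda>y. u x * x y)) = 0" and "b \<in> \<delta> ` A"
    then obtain a where a: "a \<in> A" "b = \<delta> a" by blast
    have "0 = (\<Sum>x\<in>\<delta> ` A. (\<lambda>y. u x * x y)) a" using u by simp
    also have "\<dots> = (\<Sum>x\<in>A. u (\<delta> x) * \<delta> x a)"
      by (simp add: sum_fun_apply sum.reindex[OF inj] o_def)
    also have "\<dots> = u b"
      using assms(1) a by (simp add: \<delta>_def if_distrib cong: if_cong)
    finally show "u b = 0" by simp
  qed
  moreover have "S \<subseteq> fun_space.span (\<delta> ` A)"
  proof
    fix c assume c: "c \<in> S"
    have "c = (\<Sum>a\<in>A. (\<lambda>y. c a * \<delta> a y))"
      using c assms(1)
      by (auto simp: fun_eq_iff sum_fun_apply \<delta>_def S_def if_distrib cong: if_cong)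
    moreover have "(\<Sum>a\<in>A. (\<lambda>y. c a * \<delta> a y)) \<in> fun_space.span (\<delta> ` A)"
      by (intro fun_space.span_sum fun_space.span_scale fun_space.span_base) auto
    ultimately show "c \<in> fun_space.span (\<delta> ` A)" by simp
  qed
  moreover have "\<delta> ` A \<subseteq> S"
    by (auto simp: \<delta>_def S_def split: if_splits)
  ultimately show "\<exists>B. finite B \<and> S \<subseteq> fun_space.span B" "fun_space.dim S = card A"
    using assms(1) fun_space.basis_card_eq_dim[of "\<delta> ` A" S] card_image[OF inj] by auto
qed


subsection \<open>The simplicial chain complex\<close>

lemma simplicial_complexD:
  assumes "simplicial_complex V \<Gamma>"
  shows "finite \<Gamma>" "finite (\<Union>\<Gamma>)" "{} \<in> \<Gamma>" "F \<in> \<Gamma> \<Longrightarrow> finite F"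
    "F \<in> \<Gamma> \<Longrightarrow> G \<subseteq> F \<Longrightarrow> G \<in> \<Gamma>"
  using assms finite_subset[of \<Gamma> "Pow V"] finite_subset[of _ V]
  unfolding simplicial_complex_def by (auto intro: finite_subset[of _ V])

lemma chain_boundary_linear:
  "Vector_Spaces.linear (\<lambda>(a::'k::field) c x. a * c x) (\<lambda>a c x. a * c x) (chain_boundary \<Gamma>)"
  by unfold_locales
    (auto simp: chain_boundary_def fun_eq_iff algebra_simps sum.distrib sum_distrib_left)

lemma chains_subspace: "fun_space.subspace (chains \<Gamma> i)"
  by (auto intro!: fun_space.subspaceI simp: chains_def) (metis add.right_neutral)+

lemma chain_boundary_chains:
  assumes "simplicial_complex V \<Gamma>" "c \<in> chains \<Gamma> i"
  shows "chain_boundary \<Gamma> c \<in> chains \<Gamma> (i - 1)"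
proof -
  have "G \<in> \<Gamma> \<and> face_dim G = i - 1" if "chain_boundary \<Gamma> c G \<noteq> 0" for G
  proof -
    obtain v where v: "v \<in> \<Union>\<Gamma> - G" "c (insert v G) \<noteq> 0"
      using \<open>chain_boundary \<Gamma> c G \<noteq> 0\<close> sum.neutral unfolding chain_boundary_def
      by (metis (no_types, lifting) mult_zero_right)
    then have *: "insert v G \<in> \<Gamma>" "face_dim (insert v G) = i"
      using assms(2) by (auto simp: chains_def)
    then have "G \<in> \<Gamma>" "finite G"
      using simplicial_complexD[OF assms(1)] by blast+
    then show ?thesis using * v by (simp add: face_dim_def)
  qed
  then show ?thesis by (auto simp: chains_def)
qed

text \<open>The pairs with \<open>v < w\<close> cancel against their mirror images. This is the
  cancellation that makes a boundary of a boundary zero: two vertices are deleted in either order,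
  with opposite signs.\<close>

lemma sum_antisymmetric_offdiagonal:
  fixes s :: "'a::linorder \<Rightarrow> 'a \<Rightarrow> 'b::ab_group_add"
  assumes "finite A" "\<And>v w. v \<in> A \<Longrightarrow> w \<in> A \<Longrightarrow> v < w \<Longrightarrow> s w v = - s v w"
  shows "(\<Sum>v\<in>A. \<Sum>w\<in>A - {v}. s v w) = 0"
proof -
  let ?L = "{(v, w) \<in> A \<times> A. v < w}" and ?R = "{(v, w) \<in> A \<times> A. w < v}"
  have fin: "finite ?L" "finite ?R"
    using assms(1) by (auto intro: finite_subset[of _ "A \<times> A"])
  have "(\<Sum>v\<in>A. \<Sum>w\<in>A - {v}. s v w) = (\<Sum>(v, w)\<in>(SIGMA v:A. A - {v}). s v w)"
    using assms(1) by (intro sum.Sigma) auto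
  also have "(SIGMA v:A. A - {v}) = ?L \<union> ?R" by auto
  also have "(\<Sum>(v, w)\<in>?L \<union> ?R. s v w) = (\<Sum>(v, w)\<in>?L. s v w) + (\<Sum>(v, w)\<in>?R. s v w)"
    using fin by (intro sum.union_disjoint) auto
  also have "(\<Sum>(v, w)\<in>?R. s v w) = (\<Sum>(v, w)\<in>?L. s w v)"
    by (rule sum.reindex_bij_witness[of _ prod.swap prod.swap]) auto
  also have "\<dots> = (\<Sum>(v, w)\<in>?L. - s v w)"
    using assms(2) by (intro sum.cong) auto
  finally show ?thesis by (simp add: sum_negf case_prod_unfold)
qed

lemma chain_boundary_boundary:
  fixes c :: "'v::linorder set \<Rightarrow> 'k::field"
  assumes "simplicial_complex V \<Gamma>" and c: "c \<in> chains \<Gamma> i"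
  shows "chain_boundary \<Gamma> (chain_boundary \<Gamma> c) = (\<lambda>_. 0)"
proof
  fix G
  note \<Gamma> = simplicial_complexD[OF assms(1)]
  define \<epsilon> :: "'v \<Rightarrow> 'v set \<Rightarrow> 'k" where "\<epsilon> v H = (-1) ^ card {w \<in> H. w < v}" for v H
  have boundary: "chain_boundary \<Gamma> b H = (\<Sum>v\<in>\<Union>\<Gamma> - H. \<epsilon> v H * b (insert v H))" for b H
    by (simp add: chain_boundary_def \<epsilon>_def)
  show "chain_boundary \<Gamma> (chain_boundary \<Gamma> c) G = 0"
  proof (cases "finite G")
    \<comment> \<open>\<open>card\<close> gives no meaningful position in an infinite set, but then
      every coefficient involved is zero, since faces are finite.\<close>
    case False
    then have "c (insert w (insert v G)) = 0" for v w
      using c \<Gamma>(4)[of "insert w (insert v G)"] by (auto simp: chains_def)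
    then show ?thesis by (simp add: chain_boundary_def)
  next
    case True
    define s where "s v w = \<epsilon> v G * (\<epsilon> w (insert v G) * c (insert w (insert v G)))" for v w
    have "\<Union>\<Gamma> - insert v G = \<Union>\<Gamma> - G - {v}" for v by auto
    then have "chain_boundary \<Gamma> (chain_boundary \<Gamma> c) G =
        (\<Sum>v\<in>\<Union>\<Gamma> - G. \<Sum>w\<in>\<Union>\<Gamma> - G - {v}. s v w)"
      by (simp add: boundary s_def sum_distrib_left)
    also have "\<dots> = 0"
    proof (rule sum_antisymmetric_offdiagonal)
      show "finite (\<Union>\<Gamma> - G)" using \<Gamma> by simp
    next
      fix v w assume vw: "v \<in> \<Union>\<Gamma> - G" "w \<in> \<Union>\<Gamma> - G" "v < w"
      \<comment> \<open>Inserting the smaller vertex \<open>v\<close> shifts the position of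
        \<open>w\<close> by one, while inserting \<open>w\<close> leaves the position of
        \<open>v\<close> unchanged. So exactly one of the two signs flips.\<close>
      have "{x \<in> insert v G. x < w} = insert v {x \<in> G. x < w}"
        "{x \<in> insert w G. x < v} = {x \<in> G. x < v}"
        using vw by auto
      then have "\<epsilon> w (insert v G) = - \<epsilon> w G" "\<epsilon> v (insert w G) = \<epsilon> v G"
        using vw True by (auto simp: \<epsilon>_def)
      then show "s w v = - s v w"
        by (simp add: s_def insert_commute)
    qed
    finally show ?thesis .
  qed
qed

section \<open>Homology classes, cycles and boundaries\<close>

lemma boundaries_zero: "(\<lambda>_. 0) \<in> boundaries \<Gamma> i"
  unfolding boundaries_def
  by (rule image_eqI[of _ _ "\<lambda>_. 0"]) (auto simp: chain_boundary_def chains_def)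

lemma homology_class_self: "z \<in> cycles \<Gamma> i \<Longrightarrow> z \<in> homology_class \<Gamma> i z"
  using boundaries_zero by (simp add: homology_class_def)

text \<open>A cycle lies in its own class, which is the class of zero. This replaces a statement
  about quotient classes by an equality of subspaces, whose dimensions can be counted.\<close>

lemma homology_vanishes_imp_cycles_eq_boundaries:
  assumes "simplicial_complex V \<Gamma>" "homology_vanishes TYPE('k::field) \<Gamma> i"
  shows "(cycles \<Gamma> i :: ('v::linorder set \<Rightarrow> 'k) set) = boundaries \<Gamma> i"
proof (intro equalityI subsetI)
  fix z :: "'v set \<Rightarrow> 'k"
  assume z: "z \<in> cycles \<Gamma> i"
  then have "homology_class \<Gamma> i z = homology_class \<Gamma> i (\<lambda>_. 0)"
    using assms(2) by (auto simp: homology_vanishes_def homology_def)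
  then have "z \<in> homology_class \<Gamma> i (\<lambda>_. 0)"
    using homology_class_self[OF z] by simp
  then show "z \<in> boundaries \<Gamma> i" by (simp add: homology_class_def)
next
  fix z :: "'v set \<Rightarrow> 'k"
  assume "z \<in> boundaries \<Gamma> i"
  then show "z \<in> cycles \<Gamma> i"
    using chain_boundary_chains[OF assms(1), of _ "i + 1"] chain_boundary_boundary[OF assms(1)]
    by (auto simp: boundaries_def cycles_def)
qed

section \<open>Dimensions of the spaces of chains, cycles and boundaries\<close>

lemma dim_chains:
  assumes "simplicial_complex V \<Gamma>"
  shows "fun_space.dim (chains \<Gamma> i :: ('v set \<Rightarrow> 'k::field) set) = f_num \<Gamma> i"
proof -
  have "finite {F \<in> \<Gamma>. face_dim F = i}"
    using simplicial_complexD(1)[OF assms] by simp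
  from dim_supported[OF this, where 'k = 'k] show ?thesis
    by (simp add: chains_def f_num_def)
qed

text \<open>On \<open>i\<close>-chains the boundary map has the \<open>i\<close>-cycles as kernel
  and, by the index shift in \<open>boundaries\<close>, the boundaries of degree
  \<open>i - 1\<close> as image.\<close>

lemma dim_chains_rank_nullity:
  assumes "simplicial_complex V \<Gamma>"
  shows "f_num \<Gamma> i = fun_space.dim (cycles \<Gamma> i :: ('v::linorder set \<Rightarrow> 'k::field) set) +
    fun_space.dim (boundaries \<Gamma> (i - 1) :: ('v set \<Rightarrow> 'k) set)"
proof -
  have "finite {F \<in> \<Gamma>. face_dim F = i}"
    using simplicial_complexD(1)[OF assms] by simp
  from supported_finite_span[OF this, where 'k = 'k]
  obtain B :: "('v set \<Rightarrow> 'k) set" where "finite B" "chains \<Gamma> i \<subseteq> fun_space.span B"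
    unfolding chains_def by auto
  from fun_space.rank_nullity[OF chain_boundary_linear chains_subspace this]
  have "f_num \<Gamma> i = fun_space.dim {c \<in> chains \<Gamma> i. chain_boundary \<Gamma> c = (0 :: 'v set \<Rightarrow> 'k)} +
      fun_space.dim (chain_boundary \<Gamma> ` chains \<Gamma> i :: ('v set \<Rightarrow> 'k) set)"
    by (simp only: dim_chains[OF assms])
  then show ?thesis by (simp add: cycles_def boundaries_def zero_fun_def)
qed

lemma chains_eq_zero:
  assumes "\<And>F. F \<in> \<Gamma> \<Longrightarrow> face_dim F \<noteq> i"
  shows "chains \<Gamma> i = {\<lambda>_. 0}"
  using assms by (auto simp: chains_def fun_eq_iff)

lemma boundaries_eq_zero:
  fixes \<Gamma> :: "'v::linorder set set"
  assumes "\<And>F. F \<in> \<Gamma> \<Longrightarrow> face_dim F \<noteq> i + 1"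
  shows "boundaries \<Gamma> i = {\<lambda>_. 0 :: 'k::field}"
proof -
  have "chains \<Gamma> (i + 1) = {\<lambda>_. 0 :: 'k}"
    using assms by (rule chains_eq_zero)
  then show ?thesis by (simp add: boundaries_def chain_boundary_def)
qed

lemma dim_zero_space: "fun_space.dim {\<lambda>_ :: 'x. 0 :: 'k::field} = 0"
proof -
  have "fun_space.dim {0 :: 'x \<Rightarrow> 'k} = 0"
    using fun_space.dim_eq_card[OF _ fun_space.independent_empty, of "{0}"] by simp
  then show ?thesis by (simp only: zero_fun_def)
qed

text \<open>There is no chain above the top degree, so the top cycles are the top homology.\<close>

lemma dim_top_cycles_iso_field:
  assumes iso: "homology_iso_field TYPE('k::field) \<Gamma> i"
    and top: "\<And>F. F \<in> \<Gamma> \<Longrightarrow> face_dim F \<noteq> i + 1"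
  shows "fun_space.dim (cycles \<Gamma> i :: ('v::linorder set \<Rightarrow> 'k) set) = 1"
proof -
  let ?Z = "cycles \<Gamma> i :: ('v set \<Rightarrow> 'k) set"
  obtain \<phi> :: "('v set \<Rightarrow> 'k) set \<Rightarrow> 'k" where
    bij: "bij_betw \<phi> (homology \<Gamma> i) UNIV" and
    scale: "\<And>a x. x \<in> ?Z \<Longrightarrow>
      \<phi> (homology_class \<Gamma> i (\<lambda>F. a * x F)) = a * \<phi> (homology_class \<Gamma> i x)"
    using iso unfolding homology_iso_field_def by blast
  have sub: "(\<lambda>F. a * x F) \<in> ?Z" if "x \<in> ?Z" for a x
    using that by (auto simp: cycles_def chains_def chain_boundary_def fun_eq_iff
        mult.left_commute simp flip: sum_distrib_left)
  \<comment> \<open>The cycle \<open>z\<close> represents the class sent to 1; it turns out to span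
    all cycles.\<close>
  have "1 \<in> \<phi> ` homology \<Gamma> i" using bij by (simp add: bij_betw_def)
  then obtain z where z: "z \<in> ?Z" "\<phi> (homology_class \<Gamma> i z) = 1"
    by (auto simp: homology_def)
  have "z \<noteq> 0"
  proof
    assume "z = 0"
    then show False using scale[OF z(1), of 0] z(2) by (simp add: zero_fun_def)
  qed
  have "x \<in> fun_space.span {z}" if x: "x \<in> ?Z" for x
  proof -
    \<comment> \<open>The multiple of \<open>z\<close> with the same value under
      \<open>\<phi>\<close> as \<open>x\<close>. Injectivity puts \<open>x\<close> and
      \<open>y\<close> in one class, and since zero is the only boundary in degree \<open>i\<close>
      they are equal.\<close>
    define y where "y = (\<lambda>F. \<phi> (homology_class \<Gamma> i x) * z F)"
    have y: "y \<in> ?Z" unfolding y_def by (rule sub[OF z(1)])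
    have "\<phi> (homology_class \<Gamma> i y) = \<phi> (homology_class \<Gamma> i x)"
      unfolding y_def using scale[OF z(1)] z(2) by simp
    then have "homology_class \<Gamma> i y = homology_class \<Gamma> i x"
      using bij x y by (auto simp: bij_betw_def inj_on_def homology_def)
    then have "x \<in> homology_class \<Gamma> i y"
      using homology_class_self[OF x] by simp
    then have "(\<lambda>F. x F - y F) = (\<lambda>_. 0)"
      using boundaries_eq_zero[OF top, where 'k = 'k] by (auto simp: homology_class_def)
    then have "x = y" by (auto simp: fun_eq_iff)
    then show ?thesis
      unfolding y_def fun_space.span_singleton by auto
  qed
  then show ?thesis
    using \<open>z \<noteq> 0\<close> z(1) by (intro fun_space.dim_unique[of "{z}"]) auto
qed


subsection \<open>Face counts and Euler characteristics\<close>

lemma sum_faces_by_card: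
  fixes g :: "nat \<Rightarrow> 'b::comm_semiring_1"
  assumes "finite \<Gamma>" "\<And>F. F \<in> \<Gamma> \<Longrightarrow> card F \<le> m"
  shows "(\<Sum>F\<in>\<Gamma>. g (card F)) = (\<Sum>k\<le>m. of_nat (f_num \<Gamma> (int k - 1)) * g k)"
proof -
  have "(\<Sum>F\<in>\<Gamma>. g (card F)) = (\<Sum>k\<le>m. \<Sum>F\<in>{F \<in> \<Gamma>. card F = k}. g (card F))"
    using assms by (intro sum.group[symmetric]) auto
  also have "\<dots> = (\<Sum>k\<le>m. of_nat (f_num \<Gamma> (int k - 1)) * g k)"
    by (auto simp: f_num_def face_dim_def intro!: sum.cong)
  finally show ?thesis .
qed

text \<open>The Euler-Poincare formula. Below the top degree cycles are boundaries, so each face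
  number is a sum of two consecutive cycle dimensions and the alternating sum telescopes, leaving
  only the last one.\<close>

lemma alternating_sum_faces_top_cycles:
  fixes \<Gamma> :: "'v::linorder set set"
  assumes \<Gamma>: "simplicial_complex V \<Gamma>" and m: "\<And>F. F \<in> \<Gamma> \<Longrightarrow> card F \<le> m"
    and van: "\<And>i. i < int m - 1 \<Longrightarrow> homology_vanishes TYPE('k::field) \<Gamma> i"
  shows "(\<Sum>F\<in>\<Gamma>. (-1) ^ card F :: real) =
    (-1) ^ m * real (fun_space.dim (cycles \<Gamma> (int m - 1) :: ('v set \<Rightarrow> 'k) set))"
proof -
  define z where "z k = fun_space.dim (cycles \<Gamma> (int k - 1) :: ('v set \<Rightarrow> 'k) set)" for k
  have "(\<Sum>j\<le>k. real (f_num \<Gamma> (int j - 1)) * (-1) ^ j) = (-1) ^ k * real (z k)"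
    if "k \<le> m" for k
    using that
  proof (induction k)
    \<comment> \<open>The induction starts at degree -1: there are no nonzero chains below the empty
      face, and its boundary is zero.\<close>
    case 0
    have "chains \<Gamma> (- 2) = {\<lambda>_. 0 :: 'k}"
      by (rule chains_eq_zero) (simp add: face_dim_def)
    then have "boundaries \<Gamma> (- 2) = {\<lambda>_. 0 :: 'k}"
      using chain_boundary_chains[OF \<Gamma>, of _ "- 1", where 'b = 'k]
        boundaries_zero[of \<Gamma> "- 2", where 'b = 'k]
      by (auto simp: boundaries_def)
    then show ?case
      using dim_chains_rank_nullity[OF \<Gamma>, of "-1", where 'k = 'k]
      by (simp add: z_def dim_zero_space)
  next
    case (Suc k)
    have "(cycles \<Gamma> (int k - 1) :: ('v set \<Rightarrow> 'k) set) = boundaries \<Gamma> (int k - 1)"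
      using Suc.prems van by (intro homology_vanishes_imp_cycles_eq_boundaries[OF \<Gamma>]) auto
    then have "f_num \<Gamma> (int (Suc k) - 1) = z (Suc k) + z k"
      using dim_chains_rank_nullity[OF \<Gamma>, of "int k", where 'k = 'k] by (simp add: z_def)
    then show ?case
      using Suc by (simp add: algebra_simps)
  qed
  then show ?thesis
    using sum_faces_by_card[OF simplicial_complexD(1)[OF \<Gamma>] m, of "\<lambda>k. (-1) ^ k :: real"]
    by (simp add: z_def)
qed

lemma complex_dim_card_le:
  assumes "finite \<Gamma>" "complex_dim \<Gamma> = int D - 1" "F \<in> \<Gamma>"
  shows "card F \<le> D"
proof -
  have "face_dim F \<le> complex_dim \<Gamma>"
    unfolding complex_dim_def using assms by simp
  then show ?thesis using assms(2) by (simp add: face_dim_def)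
qed

text \<open>The global sign comes from dimension being cardinality minus one.\<close>

lemma reduced_euler_char_alt:
  assumes "finite \<Gamma>" "complex_dim \<Gamma> = int D - 1"
  shows "reduced_euler_char \<Gamma> = - (\<Sum>F\<in>\<Gamma>. (-1) ^ card F)"
proof -
  have "reduced_euler_char \<Gamma> = (\<Sum>k\<le>D. (-1) powi (int k - 1) * real (f_num \<Gamma> (int k - 1)))"
    unfolding reduced_euler_char_def assms(2)
    by (rule sum.reindex_bij_witness[of _ "\<lambda>k. int k - 1" "\<lambda>i. nat (i + 1)"]) auto
  also have "\<dots> = - (\<Sum>k\<le>D. real (f_num \<Gamma> (int k - 1)) * (-1) ^ k)"
    by (simp add: power_int_diff mult.commute flip: sum_negf)
  also have "\<dots> = - (\<Sum>F\<in>\<Gamma>. (-1) ^ card F)"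
    using sum_faces_by_card[OF assms(1) complex_dim_card_le[OF assms], of "\<lambda>k. (-1) ^ k :: real"]
    by simp
  finally show ?thesis .
qed

section \<open>Links of faces\<close>

lemma simplicial_complex_link:
  assumes "simplicial_complex V \<Delta>" "F \<in> \<Delta>"
  shows "simplicial_complex (\<Union>(link \<Delta> F)) (link \<Delta> F)"
proof -
  note \<Delta> = simplicial_complexD[OF assms(1)]
  have down: "H \<in> link \<Delta> F" if "G \<in> link \<Delta> F" "H \<subseteq> G" for G H
  proof -
    have "H \<union> F \<subseteq> G \<union> F" using that(2) by blast
    then show ?thesis using that \<Delta>(5) by (auto simp: link_def)
  qed
  moreover have "finite (\<Union>(link \<Delta> F))"
    using \<Delta>(2) by (rule finite_subset[rotated]) (auto simp: link_def)
  moreover have "{} \<in> link \<Delta> F" using \<Delta>(3) assms(2) by (simp add: link_def)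
  ultimately show ?thesis
    unfolding simplicial_complex_def by (auto intro: down)
qed

text \<open>Removing \<open>G\<close> is a bijection from the faces above \<open>G\<close> to the
  link of \<open>G\<close>, and it lowers the cardinality by \<open>card G\<close>.\<close>

lemma sum_faces_above_eq_sum_link:
  assumes "simplicial_complex V \<Delta>" "G \<in> \<Delta>"
  shows "(\<Sum>F\<in>{F \<in> \<Delta>. G \<subseteq> F}. (-1) ^ card F :: real) =
    (-1) ^ card G * (\<Sum>H\<in>link \<Delta> G. (-1) ^ card H)"
proof -
  note \<Delta> = simplicial_complexD[OF assms(1)]
  have "(\<Sum>F\<in>{F \<in> \<Delta>. G \<subseteq> F}. (-1) ^ card F :: real) =
      (\<Sum>H\<in>link \<Delta> G. (-1) ^ card G * (-1) ^ card H)"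
  proof (rule sum.reindex_bij_witness[of _ "\<lambda>H. H \<union> G" "\<lambda>F. F - G"])
    fix F assume F: "F \<in> {F \<in> \<Delta>. G \<subseteq> F}"
    then show "F - G \<union> G = F" "F - G \<in> link \<Delta> G"
      using \<Delta>(5)[of F "F - G"] by (auto simp: link_def Un_absorb2)
    have "card F = card G + card (F - G)"
      using F \<Delta>(4) by (metis (mono_tags, lifting) mem_Collect_eq card_Diff_subset card_mono
          finite_subset le_add_diff_inverse)
    then show "(-1) ^ card G * (-1) ^ card (F - G) = ((-1) ^ card F :: real)"
      by (simp add: power_add)
  qed (auto simp: link_def)
  then show ?thesis by (simp add: sum_distrib_left)
qed


subsection \<open>The h-polynomial and its reversal\<close>

text \<open>The share of one face in the h-polynomial of a complex of dimension
  \<open>D - 1\<close>. \<open>D\<close> is a parameter because boundary faces are also weighted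
  with the \<open>D\<close> of the whole manifold.\<close>

definition face_poly :: "nat \<Rightarrow> 'v set \<Rightarrow> real poly" where
  "face_poly D F = monom 1 (card F) * [:1, -1:] ^ (D - card F)"

lemma h_poly_alt:
  assumes "finite \<Gamma>" "complex_dim \<Gamma> = int D - 1"
  shows "h_poly \<Gamma> = (\<Sum>F\<in>\<Gamma>. face_poly D F)"
proof -
  have "monom (real n) k * p = of_nat n * (monom 1 k * p)" for n k and p :: "real poly"
    by (simp add: of_nat_poly smult_monom flip: mult.assoc)
  moreover have "nat (complex_dim \<Gamma> + 1) = D" using assms(2) by simp
  ultimately show ?thesis
    using sum_faces_by_card[OF assms(1) complex_dim_card_le[OF assms],
        of "\<lambda>k. monom 1 k * [:1, -1:] ^ (D - k) :: real poly"]
    by (simp only: face_poly_def h_poly_def Let_def atMost_atLeast0)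
qed

lemma coeff_linear_poly_power':
  fixes a b :: "'a::comm_semiring_1"
  shows "coeff ([:a, b:] ^ n) i = (if i \<le> n then of_nat (n choose i) * b ^ i * a ^ (n - i) else 0)"
proof (cases "i \<le> n")
  case False
  have "degree ([:a, b:] ^ n) \<le> degree [:a, b:] * n" by (rule degree_power_le)
  also have "\<dots> \<le> 1 * n" by (intro mult_right_mono) auto
  finally show ?thesis using False by (simp add: coeff_eq_0)
qed (simp add: coeff_linear_poly_power)

text \<open>Substituting 1/\<lambda> and multiplying by \<lambda>^D turns \<lambda>^k (1 -
  \<lambda>)^(D - k) into (\<lambda> - 1)^(D - k). On coefficients this is the symmetry of binomial
  coefficients; when \<open>i\<close> exceeds \<open>D - card F\<close>, both sides are
  zero.\<close>

lemma coeff_face_poly_reverse: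
  assumes "card F \<le> D" "i \<le> D"
  shows "coeff (face_poly D F) (D - i) = coeff ([:-1, 1:] ^ (D - card F)) i"
proof (cases "i \<le> D - card F")
  case True
  then have "(D - card F) choose (D - i - card F) = (D - card F) choose i"
    using assms by (metis binomial_symmetric diff_commute)
  moreover have "D - i - card F = D - card F - i" "card F \<le> D - i"
    "D - card F - i \<le> D - card F"
    using True assms by auto
  ultimately show ?thesis
    using True by (simp add: face_poly_def coeff_monom_mult coeff_linear_poly_power')
next
  case False
  then show ?thesis
    using assms by (simp add: face_poly_def coeff_monom_mult coeff_linear_poly_power')
qed

text \<open>Once (1 - \<lambda>)^(D - |F|) is taken out, the sum is the expansion of (\<lambda> + (1
  - \<lambda>))^|F| = 1 over the subsets of \<open>F\<close>.\<close>

lemma sum_Pow_face_poly: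
  assumes "finite F" "card F \<le> D"
  shows "(\<Sum>G\<in>Pow F. face_poly D G) = [:1, -1:] ^ (D - card F)"
proof -
  let ?x = "monom 1 1 :: real poly" and ?y = "[:1, -1:] :: real poly"
  have "(\<Sum>G\<in>Pow F. face_poly D G) =
      (\<Sum>G\<in>Pow F. ?y ^ (D - card F) * ((\<Prod>x\<in>G. ?x) * (\<Prod>x\<in>F - G. ?y)))"
  proof (rule sum.cong)
    fix G assume "G \<in> Pow F"
    then have "card G \<le> card F" "card (F - G) = card F - card G"
      using assms(1) by (auto simp: card_mono card_Diff_subset finite_subset)
    moreover from this have "?y ^ (D - card G) = ?y ^ (D - card F) * ?y ^ (card F - card G)"
      using assms(2) by (simp only: flip: power_add) simp
    ultimately show "face_poly D G =
        ?y ^ (D - card F) * ((\<Prod>x\<in>G. ?x) * (\<Prod>x\<in>F - G. ?y))"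
      by (simp add: face_poly_def monom_power mult_ac)
  qed simp
  also have "\<dots> = ?y ^ (D - card F) * (\<Prod>x\<in>F. ?x + ?y)"
    using prod_add[OF assms(1), of "\<lambda>_. ?x" "\<lambda>_. ?y"] by (simp flip: sum_distrib_left)
  also have "?x + ?y = 1" by (simp add: monom_altdef one_pCons)
  finally show ?thesis by simp
qed

text \<open>Each (\<lambda> - 1)^(D - |F|) is a sign times (1 - \<lambda>)^(D - |F|), which
  \<open>sum_Pow_face_poly\<close> spreads over the subsets of \<open>F\<close>. After exchanging
  the sums, \<open>G\<close> collects the signs of all faces above it.\<close>

lemma reversed_face_sum:
  assumes \<Delta>: "simplicial_complex V \<Delta>" and D: "\<And>F. F \<in> \<Delta> \<Longrightarrow> card F \<le> D"
  shows "(\<Sum>F\<in>\<Delta>. [:-1, 1:] ^ (D - card F) :: real poly) =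
    (\<Sum>G\<in>\<Delta>. smult ((-1) ^ D * (\<Sum>F\<in>{F \<in> \<Delta>. G \<subseteq> F}. (-1) ^ card F)) (face_poly D G))"
proof -
  note \<Delta>' = simplicial_complexD[OF \<Delta>]
  have "(\<Sum>G\<in>\<Delta>. smult ((-1) ^ D * (\<Sum>F\<in>{F \<in> \<Delta>. G \<subseteq> F}. (-1) ^ card F)) (face_poly D G)) =
      (\<Sum>G\<in>\<Delta>. \<Sum>F | F \<in> \<Delta> \<and> G \<subseteq> F. smult ((-1) ^ D * (-1) ^ card F) (face_poly D G))"
    by (simp add: sum_distrib_left smult_sum)
  also have "\<dots> = (\<Sum>F\<in>\<Delta>. \<Sum>G | G \<in> \<Delta> \<and> G \<subseteq> F. smult ((-1) ^ D * (-1) ^ card F) (face_poly D G))"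
    by (rule sum.swap_restrict) (use \<Delta>' in auto)
  also have "\<dots> = (\<Sum>F\<in>\<Delta>. [:-1, 1:] ^ (D - card F))"
  proof (rule sum.cong)
    fix F assume F: "F \<in> \<Delta>"
    have sign: "(-1) ^ D * (-1) ^ card F = ((-1) ^ (D - card F) :: real)"
      using D[OF F] by (simp add: minus_one_power_iff)
    from F have "{G. G \<in> \<Delta> \<and> G \<subseteq> F} = Pow F" using \<Delta>'(5) by auto
    then have "(\<Sum>G | G \<in> \<Delta> \<and> G \<subseteq> F. smult ((-1) ^ D * (-1) ^ card F) (face_poly D G)) =
        [:(-1) ^ D * (-1) ^ card F:] * (\<Sum>G\<in>Pow F. face_poly D G)"
      by (simp add: sum_distrib_left)
    also have "\<dots> = smult ((-1) ^ (D - card F)) ([:1, -1:] ^ (D - card F))"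
      using sum_Pow_face_poly[OF \<Delta>'(4)[OF F] D[OF F]] sign by simp
    also have "smult ((-1) ^ (D - card F)) ([:1, -1:] ^ (D - card F)) =
        (smult (-1) [:1, -1:]) ^ (D - card F)"
      by (simp only: smult_power)
    finally show "(\<Sum>G | G \<in> \<Delta> \<and> G \<subseteq> F. smult ((-1) ^ D * (-1) ^ card F) (face_poly D G)) =
        [:-1, 1:] ^ (D - card F)"
      by simp
  qed simp
  finally show ?thesis by simp
qed

section \<open>The h- and g-numbers as polynomial coefficients\<close>

lemma h_num_eq_coeff:
  assumes "finite \<Gamma>" "complex_dim \<Gamma> = int D - 1"
  shows "h_num \<Gamma> (int j) = coeff (h_poly \<Gamma>) j"
proof (cases "j \<le> D")
  case False
  \<comment> \<open>Beyond \<open>D\<close> the value of \<open>h_num\<close> is 0 by definition;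
    the coefficient agrees, because every face term has degree at most \<open>D\<close>.\<close>
  have "coeff (face_poly D F) j = 0" if "F \<in> \<Gamma>" for F
    using complex_dim_card_le[OF assms that] False
    by (simp add: face_poly_def coeff_monom_mult coeff_linear_poly_power')
  then have "coeff (h_poly \<Gamma>) j = 0"
    by (simp add: h_poly_alt[OF assms] coeff_sum)
  then show ?thesis using False assms(2) by (simp add: h_num_def)
qed (use assms(2) in \<open>simp add: h_num_def\<close>)

text \<open>Raising \<open>D\<close> by one multiplies every face term by 1 - \<lambda>, and
  multiplication by 1 - \<lambda> takes differences of consecutive coefficients.\<close>

lemma g_num_eq_coeff:
  assumes "finite \<Gamma>" "complex_dim \<Gamma> = int D - 1"
  shows "g_num \<Gamma> (int i) = coeff (\<Sum>F\<in>\<Gamma>. face_poly (Suc D) F) i"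
proof -
  have "face_poly (Suc D) F = [:1, -1:] * face_poly D F" if "F \<in> \<Gamma>" for F
    using complex_dim_card_le[OF assms that]
    by (simp only: face_poly_def Suc_diff_le power_Suc mult_ac)
  then have "(\<Sum>F\<in>\<Gamma>. face_poly (Suc D) F) = [:1, -1:] * h_poly \<Gamma>"
    by (simp only: h_poly_alt[OF assms] sum_distrib_left cong: sum.cong)
  then have *: "(\<Sum>F\<in>\<Gamma>. face_poly (Suc D) F) = h_poly \<Gamma> - pCons 0 (h_poly \<Gamma>)"
    by simp
  show ?thesis
  proof (cases i)
    \<comment> \<open>Here \<open>h_num\<close> at -1 is 0 by definition, matching the zero constant
      coefficient of the shifted polynomial.\<close>
    case 0
    then show ?thesis
      using h_num_eq_coeff[OF assms, of 0] by (simp add: * g_num_def) (simp add: h_num_def)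
  next
    case (Suc j)
    then have "int i - 1 = int j" by simp
    then show ?thesis
      using Suc by (simp only: * g_num_def h_num_eq_coeff[OF assms]) simp
  qed
qed


subsection \<open>Homology manifolds\<close>

text \<open>Passing to the link and applying Euler-Poincare leaves the dimension of the top cycles
  of the link, which is 0 on the boundary and 1 in the interior. The signs with exponents
  \<open>d\<close>, \<open>card G\<close> and \<open>d - card G\<close> multiply to 1.\<close>

lemma homology_manifold_link_sum:
  fixes \<Delta> :: "'v::linorder set set"
  assumes man: "homology_manifold TYPE('k::field) V \<Delta>" and dim: "complex_dim \<Delta> = int d - 1"
    and G: "G \<in> \<Delta>" "G \<noteq> {}"
  shows "(-1) ^ d * (\<Sum>F\<in>{F \<in> \<Delta>. G \<subseteq> F}. (-1) ^ card F) =
    (if G \<in> boundary_faces TYPE('k) \<Delta> then 0 else 1 :: real)"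
proof -
  have \<Delta>: "simplicial_complex V \<Delta>" using man by (simp add: homology_manifold_def)
  note \<Delta>' = simplicial_complexD[OF \<Delta>]
  have Gd: "card G \<le> d" using complex_dim_card_le[OF \<Delta>'(1) dim G(1)] .
  \<comment> \<open>Faces of the link have at most \<open>m\<close> vertices, so
    \<open>m - 1\<close> is the one degree where the manifold condition permits nonzero homology,
    and no nonzero boundaries exist there.\<close>
  define m where "m = d - card G"
  have e: "complex_dim \<Delta> - int (card G) = int m - 1"
    using dim Gd by (simp add: m_def)
  note L = simplicial_complex_link[OF \<Delta> G(1)]
  have card_link: "card H \<le> m" if "H \<in> link \<Delta> G" for H
  proof -
    have "card (H \<union> G) = card H + card G"
      using that \<Delta>'(4) by (intro card_Un_disjoint) (auto simp: link_def G)
    moreover have "card (H \<union> G) \<le> d"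
      using that by (intro complex_dim_card_le[OF \<Delta>'(1) dim]) (simp add: link_def)
    ultimately show ?thesis by (simp add: m_def)
  qed
  then have top: "face_dim H \<noteq> int m - 1 + 1" if "H \<in> link \<Delta> G" for H
    using that by (fastforce simp: face_dim_def)
  have van: "homology_vanishes TYPE('k) (link \<Delta> G) i" if "i < int m - 1" for i
    using man G that unfolding homology_manifold_def e[symmetric] by blast
  let ?z = "fun_space.dim (cycles (link \<Delta> G) (int m - 1) :: ('v set \<Rightarrow> 'k) set)"
  have "?z = (if G \<in> boundary_faces TYPE('k) \<Delta> then 0 else 1)"
  proof (cases "G \<in> boundary_faces TYPE('k) \<Delta>")
    case True
    then have "homology_vanishes TYPE('k) (link \<Delta> G) (int m - 1)"
      by (simp add: boundary_faces_def e)
    then have "(cycles (link \<Delta> G) (int m - 1) :: ('v set \<Rightarrow> 'k) set) = {\<lambda>_. 0}"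
      using homology_vanishes_imp_cycles_eq_boundaries[OF L] boundaries_eq_zero[OF top] by metis
    then show ?thesis using True by (simp add: dim_zero_space)
  next
    case False
    then have "homology_iso_field TYPE('k) (link \<Delta> G) (int m - 1)"
      using man G by (auto simp: boundary_faces_def homology_manifold_def e)
    from dim_top_cycles_iso_field[OF this top] False show ?thesis by simp
  qed
  moreover have "(\<Sum>H\<in>link \<Delta> G. (-1) ^ card H :: real) = (-1) ^ m * real ?z"
    by (rule alternating_sum_faces_top_cycles[OF L card_link van])
  moreover have "(-1) ^ d * ((-1) ^ card G * (-1) ^ m) = (1 :: real)"
    using Gd by (simp add: m_def flip: power_add)
  ultimately show ?thesis
    by (auto simp: sum_faces_above_eq_sum_link[OF \<Delta> G(1)])
qed

theorem theorem3p1: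
  fixes \<Delta> :: "nat set set" and n d i :: nat
  assumes "infinite (UNIV :: 'k::field set)"
    and "homology_manifold_with_boundary TYPE('k) {1..n} \<Delta>"
    and "complex_dim \<Delta> = int d - 1"
    and "i \<le> d"
  shows "h_num \<Delta> (int d - int i) - h_num \<Delta> (int i) =
           real (d choose i) * (-1) powi (int d - 1 - int i) * reduced_euler_char \<Delta>
             - g_num (boundary_complex TYPE('k) \<Delta>) (int i)"
proof -
  let ?B = "boundary_complex TYPE('k) \<Delta>" and ?t = "face_poly d :: nat set \<Rightarrow> _"
  have man: "homology_manifold TYPE('k) {1..n} \<Delta>" and dimB: "complex_dim ?B = int d - 2"
    using assms(2,3) by (auto simp: homology_manifold_with_boundary_def)
  then have \<Delta>: "simplicial_complex {1..n} \<Delta>" by (simp add: homology_manifold_def)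
  note \<Delta>' = simplicial_complexD[OF \<Delta>]
  note card_le = complex_dim_card_le[OF \<Delta>'(1) assms(3)]
  have B: "?B \<subseteq> \<Delta>" "{} \<in> ?B"
    using \<Delta>'(3) by (auto simp: boundary_complex_def boundary_faces_def)
  then have finB: "finite ?B" using \<Delta>'(1) finite_subset by blast
  \<comment> \<open>The empty face gives the boundary complex dimension at least -1, so
    \<open>d\<close> is positive and its predecessor \<open>D\<close> is the parameter of the
    boundary.\<close>
  have "face_dim ({} :: nat set) \<le> complex_dim ?B"
    unfolding complex_dim_def using finB B by (intro Max_ge) auto
  then obtain D where D: "d = Suc D"
    using dimB by (cases d) (auto simp: face_dim_def)
  define w :: "nat set \<Rightarrow> real"
    where "w G = (-1) ^ d * (\<Sum>F\<in>{F \<in> \<Delta>. G \<subseteq> F}. (-1) ^ card F)" for G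
  \<comment> \<open>The weight is 1 on interior faces and 0 on nonempty boundary faces. The empty
    face belongs to \<open>?B\<close>, so its first two terms cancel and the last one restores its
    weight.\<close>
  have w: "smult (w G) (?t G) = ?t G - (if G \<in> ?B then ?t G else 0) +
      (if G = {} then smult (w G) (?t G) else 0)" if "G \<in> \<Delta>" for G
    using homology_manifold_link_sum[OF man assms(3) that]
    by (cases "G = {}") (auto simp: w_def boundary_complex_def)
  \<comment> \<open>Every face contains the empty face, so its weight is the full alternating
    sum.\<close>
  have w0: "w {} = (-1) ^ d * - reduced_euler_char \<Delta>"
    by (simp add: w_def reduced_euler_char_alt[OF \<Delta>'(1) assms(3)])
  have sign: "(-1) ^ d * (-1) ^ i = (- ((-1) powi (int d - 1 - int i)) :: real)"
    by (cases "even d"; cases "even i") (simp_all add: power_int_diff)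
  have "h_num \<Delta> (int d - int i) = coeff (h_poly \<Delta>) (d - i)"
    using h_num_eq_coeff[OF \<Delta>'(1) assms(3), of "d - i"] assms(4) by (simp add: of_nat_diff)
  also have "\<dots> = coeff (\<Sum>F\<in>\<Delta>. [:-1, 1:] ^ (d - card F)) i"
    unfolding h_poly_alt[OF \<Delta>'(1) assms(3)] coeff_sum
    by (intro sum.cong refl coeff_face_poly_reverse card_le assms(4))
  also have "(\<Sum>F\<in>\<Delta>. [:-1, 1:] ^ (d - card F)) = (\<Sum>G\<in>\<Delta>. smult (w G) (?t G))"
    unfolding w_def by (rule reversed_face_sum[OF \<Delta> card_le])
  also have "\<dots> = (\<Sum>G\<in>\<Delta>. ?t G - (if G \<in> ?B then ?t G else 0) +
      (if G = {} then smult (w G) (?t G) else 0))"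
    using w by (intro sum.cong) auto
  also have "\<dots> = h_poly \<Delta> - (\<Sum>G\<in>?B. ?t G) + smult (w {}) (?t {})"
    using \<Delta>'(1,3) B(1)
    by (simp add: sum.distrib sum_subtractf h_poly_alt[OF \<Delta>'(1) assms(3)] Int_absorb1
        flip: sum.inter_restrict)
  \<comment> \<open>Boundary faces carry the exponent \<open>d = Suc D\<close>, one more than in the
    h-polynomial of the boundary, so their sum has the g-numbers as coefficients.\<close>
  also have "coeff \<dots> i = h_num \<Delta> (int i) - g_num ?B (int i) + w {} * coeff (?t {}) i"
    using g_num_eq_coeff[OF finB, of D i] dimB D
    by (simp add: h_num_eq_coeff[OF \<Delta>'(1) assms(3)])
  also have "coeff (?t {}) i = real (d choose i) * (-1) ^ i"
    using assms(4) by (simp add: face_poly_def coeff_linear_poly_power')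
  also have "w {} * (real (d choose i) * (-1) ^ i) =
      real (d choose i) * (-1) powi (int d - 1 - int i) * reduced_euler_char \<Delta>"
    using sign by (simp add: w0 mult_ac)
  finally show ?thesis by simp
qed

end
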